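(* Let $h\colon \mathbb{Z}_+\times\mathbb{P}\to\{0,1\}$ be an arbitrary function. Let $g$ be the function on the positive integers defined by $g(1)=0$ and, for an integer $u>1$ with prime factorization $u=\prod_{i=1}^r p_i^{\alpha_i}$, by $g(u)=\sum_{i=1}^r h(\alpha_i,p_i)$. Let $Q(x;h)$ be the number of integers $n$ between $1$ and $x$ such that $g(n)=0$. Then the limit $\lim_{x\to\infty} Q(x;h)/x$ exists and $$\lim_{x\to\infty}\frac{Q(x;h)}{x}=\prod_{p}\left(1-\frac{p-1}{p}\sum_{i=1}^{\infty}\frac{h(i,p)}{p^i}\right),$$ where the product is over all primes $p$.
   Context: $\mathbb{Z}_+$ denotes the set of positive integers and $\mathbb{P}$ the set of prime numbers. In a prime factorization $u=\prod_{i=1}^r p_i^{\alpha_i}$ the primes $p_1,\dots,p_r$ are distinct and the exponents satisfy $\alpha_i\ge 1$. The infinite product over primes is understood as the limit, as $y\to\infty$, of the finite products over primes $p\le y$ (its value may be $0$). *)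

theory Defs
  imports Complex_Main "HOL-Computational_Algebra.Primes"
begin

text \<open>
  A function \<open>h : \<int>\<^sub>+ \<times> \<P> \<rightarrow> {0,1}\<close> is rendered as a total, curried function
  on \<open>nat\<close>; only its values \<open>h i p\<close> with \<open>i \<ge> 1\<close> and \<open>p\<close> prime are ever relevant.
\<close>

definition zero_one_valued :: "(nat \<Rightarrow> nat \<Rightarrow> nat) \<Rightarrow> bool" where
  "zero_one_valued h \<longleftrightarrow> (\<forall>i p. i \<ge> 1 \<longrightarrow> prime p \<longrightarrow> h i p \<in> {0, 1})"

text \<open>The sum is empty for \<open>u = 1\<close>, which gives \<open>g(1) = 0\<close>.\<close>

definition exponent_sum :: "(nat \<Rightarrow> nat \<Rightarrow> nat) \<Rightarrow> nat \<Rightarrow> nat" where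
  "exponent_sum h u = (\<Sum>p\<in>prime_factors u. h (multiplicity p u) p)"

definition Q :: "real \<Rightarrow> (nat \<Rightarrow> nat \<Rightarrow> nat) \<Rightarrow> nat" where
  "Q x h = card {n::nat. 1 \<le> n \<and> real n \<le> x \<and> exponent_sum h n = 0}"

text \<open>The series over \<open>i \<ge> 1\<close> is shifted to start at \<open>0\<close>; since \<open>h \<le> 1\<close>, it converges.\<close>

definition local_factor :: "(nat \<Rightarrow> nat \<Rightarrow> nat) \<Rightarrow> nat \<Rightarrow> real" where
  "local_factor h p =
     1 - (real p - 1) / real p * (\<Sum>i. real (h (Suc i) p) / real p ^ Suc i)"

end

theory Submission
  imports Defs "HOL-Analysis.Uniform_Limit"
begin

text \<open>
  For a finite set of primes, the integers violating no condition at these primes have density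
  equal to the finite product of local factors: a set invariant under multiplication by a further
  prime \<open>p\<close> splits into layers according to the exponent of \<open>p\<close>, the layer of exponent \<open>i\<close> is a
  dilate, and Tannery's theorem sums the layers. The partial products therefore bound the upper
  density, and they decrease to a limit \<open>L\<close>. If \<open>L = 0\<close> nothing remains. If \<open>L > 0\<close>, the local
  violation densities are summable over the primes; as the proportion of \<open>n \<le> x\<close> violating the
  condition at \<open>p\<close> is at most twice the violation density at \<open>p\<close>, uniformly in \<open>x\<close>, the primes
  beyond \<open>k\<close> matter for a proportion that tends to \<open>0\<close> with \<open>k\<close>.
\<close>

section \<open>Counting functions and natural density\<close>

text \<open>The cutoff is real so that dilating by \<open>p ^ i\<close> just replaces
  \<open>x\<close> by \<open>x / p ^ i\<close>. Positivity sits here so that complements may be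
  taken in all of \<open>nat\<close>.\<close>

definition initial :: "nat set \<Rightarrow> real \<Rightarrow> nat set" where
  "initial B x = {n \<in> B. 0 < n \<and> real n \<le> x}"

text \<open>The clause \<open>p dvd n\<close> keeps the unconstrained value \<open>h 0 p\<close>
  from affecting positive integers prime to \<open>p\<close>.\<close>

definition bad :: "(nat \<Rightarrow> nat \<Rightarrow> nat) \<Rightarrow> nat \<Rightarrow> nat set" where
  "bad h p = {n. p dvd n \<and> h (multiplicity p n) p \<noteq> 0}"

definition has_density :: "nat set \<Rightarrow> real \<Rightarrow> bool" where
  "has_density B d \<longleftrightarrow> ((\<lambda>x. real (card (initial B x)) / x) \<longlongrightarrow> d) at_top"

lemma initial_subset: "initial B x \<subseteq> {1..nat \<lfloor>x\<rfloor>}"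
  by (auto simp: initial_def le_nat_floor)

lemma finite_initial [simp]: "finite (initial B x)"
  by (rule finite_subset[OF initial_subset]) simp

lemma card_initial_le:
  assumes "0 \<le> x"
  shows "real (card (initial B x)) \<le> x"
proof -
  have "card (initial B x) \<le> card {1..nat \<lfloor>x\<rfloor>}"
    by (intro card_mono initial_subset) simp
  then show ?thesis using assms by simp linarith
qed

lemma card_initial_mono:
  assumes "A \<subseteq> B" "x \<le> y"
  shows "card (initial A x) \<le> card (initial B y)"
  using assms by (intro card_mono finite_initial) (auto simp: initial_def)

lemma initial_neg: "x \<le> 0 \<Longrightarrow> initial B x = {}"
  by (auto simp: initial_def)

lemma has_density_UNIV: "has_density UNIV 1"
proof -
  have *: "real (card (initial UNIV x)) = real_of_int \<lfloor>x\<rfloor>" if "x > 0" for x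
  proof -
    have "initial UNIV x = {1..nat \<lfloor>x\<rfloor>}"
      using that by (auto simp: initial_def le_nat_floor) linarith
    then show ?thesis using that by simp
  qed
  have lim: "((\<lambda>x::real. 1 - inverse x) \<longlongrightarrow> 1 - 0) at_top"
    by (intro tendsto_intros tendsto_inverse_0_at_top filterlim_ident)
  have "((\<lambda>x. real (card (initial UNIV x)) / x) \<longlongrightarrow> 1) at_top"
  proof (rule tendsto_sandwich)
    show "\<forall>\<^sub>F x in at_top. 1 - inverse x \<le> real (card (initial UNIV x)) / x"
      using eventually_gt_at_top[of 0]
    proof eventually_elim
      case (elim x)
      have "x - 1 \<le> real_of_int \<lfloor>x\<rfloor>" by linarith
      then have "(x - 1) / x \<le> real (card (initial UNIV x)) / x"
        using elim * by (simp add: divide_right_mono)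
      moreover have "(x - 1) / x = 1 - inverse x" using elim by (simp add: field_simps)
      ultimately show ?case by simp
    qed
    show "\<forall>\<^sub>F x in at_top. real (card (initial UNIV x)) / x \<le> 1"
      using eventually_gt_at_top[of 0]
      by eventually_elim (simp add: card_initial_le)
  qed (use lim in auto)
  then show ?thesis by (simp add: has_density_def)
qed

section \<open>Layers by the exponent of one prime\<close>

text \<open>Invariance under \<open>p\<close> iterates to \<open>p ^ i\<close>, so multiplication by
  \<open>p ^ i\<close> is a bijection between the two counted sets.\<close>

lemma card_initial_dvd:
  assumes inv: "\<And>n. n > 0 \<Longrightarrow> p * n \<in> B \<longleftrightarrow> n \<in> B" and p: "0 < p"
  shows "card (initial (B \<inter> {n. p ^ i dvd n}) x) = card (initial B (x / real p ^ i))"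
proof -
  have inv': "p ^ i * n \<in> B \<longleftrightarrow> n \<in> B" if "n > 0" for n
  proof (induction i)
    case (Suc i)
    then show ?case using inv[of "p ^ i * n"] that p by (simp add: mult.assoc)
  qed simp
  have "bij_betw (\<lambda>n. p ^ i * n) (initial B (x / real p ^ i)) (initial (B \<inter> {n. p ^ i dvd n}) x)"
    unfolding bij_betw_def
  proof
    show "inj_on (\<lambda>n. p ^ i * n) (initial B (x / real p ^ i))"
      using p by (auto intro!: inj_onI)
    show "(\<lambda>n. p ^ i * n) ` initial B (x / real p ^ i) = initial (B \<inter> {n. p ^ i dvd n}) x"
    proof (intro equalityI subsetI)
      fix m assume "m \<in> initial (B \<inter> {n. p ^ i dvd n}) x"
      then have m: "m \<in> B" "m > 0" "real m \<le> x" and "p ^ i dvd m"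
        by (auto simp: initial_def)
      from this(4) obtain n where "m = p ^ i * n" by (rule dvdE)
      with m have n: "m = p ^ i * n" "m \<in> B" "m > 0" "real m \<le> x" by simp_all
      then have "n > 0" by (cases n) auto
      moreover have "n \<in> B" using n(1,2) inv'[OF \<open>n > 0\<close>] by simp
      moreover have "real n \<le> x / real p ^ i"
        using n p by (simp add: pos_le_divide_eq mult.commute)
      ultimately show "m \<in> (\<lambda>n. p ^ i * n) ` initial B (x / real p ^ i)"
        unfolding n(1) by (intro imageI) (simp add: initial_def)
    next
      fix m assume "m \<in> (\<lambda>n. p ^ i * n) ` initial B (x / real p ^ i)"
      then obtain n where n: "m = p ^ i * n" "n \<in> B" "n > 0" "real n \<le> x / real p ^ i"
        by (auto simp: initial_def)
      then show "m \<in> initial (B \<inter> {n. p ^ i dvd n}) x"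
        using p inv'[of n] by (simp add: initial_def pos_le_divide_eq mult.commute)
    qed
  qed
  then show ?thesis by (simp add: bij_betw_same_card)
qed

text \<open>Exponent exactly \<open>i\<close> means divisible by \<open>p ^ i\<close> but not by
  \<open>p ^ Suc i\<close>: a difference of nested sets, each of them a dilate of
  \<open>B\<close>.\<close>

lemma card_initial_multiplicity:
  assumes inv: "\<And>n. n > 0 \<Longrightarrow> p * n \<in> B \<longleftrightarrow> n \<in> B" and p: "prime p"
  shows "real (card (initial (B \<inter> {n. multiplicity p n = i}) x)) =
    real (card (initial B (x / real p ^ i))) - real (card (initial B (x / real p ^ Suc i)))"
proof -
  have p0: "0 < p" using p by (simp add: prime_gt_0_nat)
  have dvd: "p ^ j dvd n \<longleftrightarrow> j \<le> multiplicity p n" if "n > 0" for n j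
    using that p by (intro power_dvd_iff_le_multiplicity) (auto simp: not_prime_unit)
  have eq: "initial (B \<inter> {n. multiplicity p n = i}) x =
      initial (B \<inter> {n. p ^ i dvd n}) x - initial (B \<inter> {n. p ^ Suc i dvd n}) x"
    using dvd by (auto simp: initial_def simp del: power_Suc)
  have sub: "initial (B \<inter> {n. p ^ Suc i dvd n}) x \<subseteq> initial (B \<inter> {n. p ^ i dvd n}) x"
    using dvd by (auto simp: initial_def simp del: power_Suc)
  show ?thesis
    unfolding eq card_Diff_subset[OF finite_initial sub]
    using card_mono[OF finite_initial sub]
    by (simp only: of_nat_diff card_initial_dvd[OF inv p0])
qed

text \<open>The layers are disjoint and \<open>h\<close> selects those that violate the condition.
  Only finitely many are nonempty for a given \<open>x\<close>; the series form allows termwise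
  comparison and a termwise limit in \<open>x\<close>.\<close>

lemma sums_card_initial_bad:
  assumes h: "zero_one_valued h" and p: "prime p"
    and inv: "\<And>n. n > 0 \<Longrightarrow> p * n \<in> B \<longleftrightarrow> n \<in> B"
  shows "(\<lambda>i. real (h (Suc i) p) * (real (card (initial B (x / real p ^ Suc i)))
      - real (card (initial B (x / real p ^ Suc (Suc i)))))) sums real (card (initial (B \<inter> bad h p) x))"
proof -
  \<comment> \<open>The index is shifted because a positive integer with exponent 0 is never in
    \<open>bad h p\<close>.\<close>
  define D where "D i = initial (B \<inter> {n. multiplicity p n = Suc i}) x" for i
  \<comment> \<open>A crude cutoff for exponents: an exponent is smaller than the corresponding
    power of \<open>p\<close>, which is at most \<open>n\<close>.\<close>
  define N where "N = nat \<lfloor>x\<rfloor>"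
  have le: "multiplicity p n \<le> N" if "n > 0" "real n \<le> x" for n
  proof -
    have "multiplicity p n < p ^ multiplicity p n"
      using p by (intro power_gt_expt) (simp add: prime_gt_Suc_0_nat)
    also have "\<dots> \<le> n"
      using that by (intro dvd_imp_le multiplicity_dvd) auto
    also have "n \<le> N" using that by (simp add: N_def le_nat_floor)
    finally show ?thesis by simp
  qed
  have dvd: "p dvd n \<longleftrightarrow> multiplicity p n \<noteq> 0" if "n > 0" for n
    by (subst multiplicity_eq_zero_iff) (use that p in \<open>auto\<close>)
  have h01: "h (Suc i) p = 0 \<or> h (Suc i) p = 1" for i
    using h p by (auto simp: zero_one_valued_def)
  have "initial (B \<inter> bad h p) x = (\<Union>i\<in>{i\<in>{..<N}. h (Suc i) p \<noteq> 0}. D i)"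
  proof (intro equalityI subsetI)
    fix n assume n: "n \<in> initial (B \<inter> bad h p) x"
    then have "n > 0" "real n \<le> x" "multiplicity p n \<noteq> 0"
      using dvd by (auto simp: initial_def bad_def)
    with n le[of n] show "n \<in> (\<Union>i\<in>{i\<in>{..<N}. h (Suc i) p \<noteq> 0}. D i)"
      by (intro UN_I[of "multiplicity p n - 1"]) (auto simp: D_def initial_def bad_def)
  next
    fix n assume "n \<in> (\<Union>i\<in>{i\<in>{..<N}. h (Suc i) p \<noteq> 0}. D i)"
    then obtain i where "h (Suc i) p \<noteq> 0" "n \<in> B" "n > 0" "real n \<le> x" "multiplicity p n = Suc i"
      by (auto simp: D_def initial_def)
    moreover from this have "p dvd n" by (simp add: dvd)
    ultimately show "n \<in> initial (B \<inter> bad h p) x"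
      by (simp add: initial_def bad_def)
  qed
  also have "card \<dots> = (\<Sum>i\<in>{i\<in>{..<N}. h (Suc i) p \<noteq> 0}. card (D i))"
    by (rule card_UN_disjoint) (auto simp: D_def, auto simp: initial_def)
  also have "\<dots> = (\<Sum>i<N. h (Suc i) p * card (D i))"
  proof (rule sum.mono_neutral_cong_left)
    show "card (D i) = h (Suc i) p * card (D i)" if "i \<in> {i \<in> {..<N}. h (Suc i) p \<noteq> 0}" for i
      using that h01[of i] by auto
  qed auto
  finally have card: "real (card (initial (B \<inter> bad h p) x)) =
      (\<Sum>i<N. real (h (Suc i) p) * real (card (D i)))" by simp
  have "D i = {}" if "i \<notin> {..<N}" for i
  proof -
    have "multiplicity p n \<noteq> Suc i" if "n > 0" "real n \<le> x" for n
      using le[OF that] \<open>i \<notin> {..<N}\<close> by auto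
    then show ?thesis by (auto simp: D_def initial_def)
  qed
  then have "(\<lambda>i. real (h (Suc i) p) * real (card (D i))) sums
      (\<Sum>i<N. real (h (Suc i) p) * real (card (D i)))"
    by (intro sums_finite) auto
  moreover have "real (card (D i)) = real (card (initial B (x / real p ^ Suc i)))
      - real (card (initial B (x / real p ^ Suc (Suc i))))" for i
    unfolding D_def by (rule card_initial_multiplicity[OF inv p])
  ultimately show ?thesis by (simp only: card)
qed

section \<open>The local series and bounds uniform in \<open>x\<close>\<close>

lemma summable_inverse_prime_powers:
  assumes "prime (p::nat)"
  shows "summable (\<lambda>i. 1 / real p ^ Suc i)"
proof -
  have "summable (\<lambda>i. (1 / real p) ^ i)"
    using prime_gt_1_nat[OF assms] by (intro summable_geometric) simp
  then have "summable (\<lambda>i. (1 / real p) ^ Suc i)"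
    by (subst summable_Suc_iff)
  then show ?thesis by (simp add: power_one_over)
qed

lemma summable_local_series:
  assumes h: "zero_one_valued h" and p: "prime p"
  shows "summable (\<lambda>i. real (h (Suc i) p) / real p ^ Suc i)"
proof (rule summable_comparison_test'[OF summable_inverse_prime_powers[OF p], of 0])
  fix i
  have "h (Suc i) p \<in> {0, 1}" using h p by (simp add: zero_one_valued_def)
  then show "norm (real (h (Suc i) p) / real p ^ Suc i) \<le> 1 / real p ^ Suc i" by auto
qed

text \<open>Dropping the subtracted count in each layer and bounding the other one trivially gives a
  linear bound valid for every \<open>x \<ge> 0\<close>, which a limit statement alone would not
  provide.\<close>

lemma card_initial_bad_le:
  assumes h: "zero_one_valued h" and p: "prime p" and x: "0 \<le> x"
  shows "real (card (initial (bad h p) x)) \<le> 2 * x * (1 - local_factor h p)"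
proof -
  let ?S = "\<Sum>i. real (h (Suc i) p) / real p ^ Suc i"
  have "real (card (initial (bad h p) x)) \<le> x * ?S"
  proof (rule sums_le)
    show "(\<lambda>i. real (h (Suc i) p) * (real (card (initial UNIV (x / real p ^ Suc i)))
      - real (card (initial UNIV (x / real p ^ Suc (Suc i)))))) sums real (card (initial (bad h p) x))"
      using sums_card_initial_bad[OF h p, of UNIV x] by simp
    show "(\<lambda>i. x * (real (h (Suc i) p) / real p ^ Suc i)) sums (x * ?S)"
      by (intro sums_mult summable_sums summable_local_series h p)
    fix i
    have "real (card (initial UNIV (x / real p ^ Suc i))) \<le> x / real p ^ Suc i"
      using x by (intro card_initial_le) simp
    then have "real (h (Suc i) p) * (real (card (initial UNIV (x / real p ^ Suc i)))
      - real (card (initial UNIV (x / real p ^ Suc (Suc i))))) \<le> real (h (Suc i) p) * (x / real p ^ Suc i)"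
      by (intro mult_left_mono) auto
    then show "real (h (Suc i) p) * (real (card (initial UNIV (x / real p ^ Suc i)))
      - real (card (initial UNIV (x / real p ^ Suc (Suc i))))) \<le> x * (real (h (Suc i) p) / real p ^ Suc i)"
      by (simp add: mult.commute)
  qed
  \<comment> \<open>The constant 2 comes from (p - 1) / p \<ge> 1/2 for p \<ge> 2.\<close>
  also have "\<dots> \<le> x * (2 * ((real p - 1) / real p * ?S))"
  proof (intro mult_left_mono x)
    have "?S \<ge> 0" by (intro suminf_nonneg summable_local_series h p) simp
    moreover have "1 \<le> 2 * ((real p - 1) / real p)"
      using prime_ge_2_nat[OF p] by (simp add: field_simps)
    ultimately have "1 * ?S \<le> 2 * ((real p - 1) / real p) * ?S" by (intro mult_right_mono)
    then show "?S \<le> 2 * ((real p - 1) / real p * ?S)" by (simp only: mult.assoc mult_1_left)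
  qed
  finally show ?thesis by (simp add: local_factor_def mult_ac)
qed

text \<open>The local series is at most the full geometric series 1 / (p - 1), so the subtracted
  quantity is at most 1 / p.\<close>

lemma local_factor_bounds:
  assumes h: "zero_one_valued h" and p: "prime p"
  shows "0 \<le> local_factor h p" "local_factor h p \<le> 1"
proof -
  let ?S = "\<Sum>i. real (h (Suc i) p) / real p ^ Suc i"
  have p1: "1 < real p" using prime_gt_1_nat[OF p] by simp
  have "?S \<ge> 0" by (intro suminf_nonneg summable_local_series h p) simp
  then show "local_factor h p \<le> 1"
    using p1 by (simp add: local_factor_def)
  have "?S \<le> 1 / (real p - 1)"
  proof (rule sums_le)
    show "(\<lambda>i. real (h (Suc i) p) / real p ^ Suc i) sums ?S"
      by (intro summable_sums summable_local_series h p)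
    have "(\<lambda>i. 1 / real p * (1 / real p) ^ i) sums (1 / real p * (1 / (1 - 1 / real p)))"
      using p1 by (intro sums_mult geometric_sums) simp
    also have "1 / real p * (1 / (1 - 1 / real p)) = 1 / (real p - 1)"
      using p1 by (simp add: field_simps)
    finally show "(\<lambda>i. 1 / real p ^ Suc i) sums (1 / (real p - 1))"
      by (simp add: power_one_over)
    fix i
    have "h (Suc i) p \<in> {0, 1}" using h p by (simp add: zero_one_valued_def)
    then show "real (h (Suc i) p) / real p ^ Suc i \<le> 1 / real p ^ Suc i" by auto
  qed
  then have "(real p - 1) / real p * ?S \<le> (real p - 1) / real p * (1 / (real p - 1))"
    using p1 by (intro mult_left_mono) auto
  also have "\<dots> \<le> 1" using p1 by simp
  finally show "0 \<le> local_factor h p" by (simp add: local_factor_def)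
qed

section \<open>Density after imposing the conditions at finitely many primes\<close>

lemma has_density_dilate:
  assumes "has_density B d" "0 < c"
  shows "((\<lambda>x. real (card (initial B (x / c))) / x) \<longlongrightarrow> d / c) at_top"
proof -
  have "filterlim (\<lambda>x. x * (1 / c)) at_top at_top"
    using assms(2)
    by (intro filterlim_at_top_mult_tendsto_pos[OF tendsto_const _ filterlim_ident]) auto
  then have "filterlim (\<lambda>x. x / c) at_top at_top" by simp
  from filterlim_compose[OF assms(1)[unfolded has_density_def] this]
  have "((\<lambda>x. real (card (initial B (x / c))) / (x / c) / c) \<longlongrightarrow> d / c) at_top"
    by (intro tendsto_intros) (use assms(2) in auto)
  then show ?thesis using assms(2) by simp
qed

text \<open>Each layer has an explicit density by dilation; a summable bound independent of
  \<open>x\<close> permits summing these densities, and the violating part is then subtracted from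
  \<open>B\<close>.\<close>

lemma has_density_diff_bad:
  assumes h: "zero_one_valued h" and p: "prime p" and d: "has_density B d"
    and inv: "\<And>n. n > 0 \<Longrightarrow> p * n \<in> B \<longleftrightarrow> n \<in> B"
  shows "has_density (B - bad h p) (d * local_factor h p)"
proof -
  have p1: "1 < real p" using prime_gt_1_nat[OF p] by simp
  let ?S = "\<Sum>i. real (h (Suc i) p) / real p ^ Suc i"
  define a where "a i x = real (h (Suc i) p) * (real (card (initial B (x / real p ^ Suc i))) / x
      - real (card (initial B (x / real p ^ Suc (Suc i)))) / x)" for i x
  define b where "b i = real (h (Suc i) p) * (d / real p ^ Suc i - d / real p ^ Suc (Suc i))" for i
  have suma: "(\<Sum>i. a i x) = real (card (initial (B \<inter> bad h p) x)) / x" for x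
    using sums_unique[OF sums_divide[OF sums_card_initial_bad[OF h p inv, of x], of x]]
    by (simp only: a_def diff_divide_distrib[symmetric] times_divide_eq_right)
  have bound: "norm (a i x) \<le> 1 / real p ^ Suc i" for i x
  proof (cases "x > 0")
    case True
    let ?u = "real (card (initial B (x / real p ^ Suc i)))"
    let ?v = "real (card (initial B (x / real p ^ Suc (Suc i))))"
    have "?v \<le> ?u"
      using p1 True by (intro of_nat_mono card_initial_mono) (auto simp: field_simps)
    moreover have "?u \<le> x / real p ^ Suc i"
      using True by (intro card_initial_le) simp
    ultimately have "0 \<le> ?u - ?v" "?u - ?v \<le> x / real p ^ Suc i"
      by auto
    then have "0 \<le> (?u - ?v) / x" "(?u - ?v) / x \<le> (x / real p ^ Suc i) / x"
      using True by (intro divide_nonneg_pos divide_right_mono; simp)+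
    moreover have "h (Suc i) p \<in> {0, 1}" using h p by (simp add: zero_one_valued_def)
    ultimately show ?thesis
      using True by (auto simp: a_def diff_divide_distrib simp del: power_Suc)
  next
    \<comment> \<open>For \<open>x \<le> 0\<close> nothing is counted and the term vanishes, so the
      bound holds for every \<open>x\<close>.\<close>
    case False
    then have "x / real p ^ j \<le> 0" for j by (simp add: divide_nonpos_nonneg)
    then show ?thesis by (simp add: a_def initial_neg del: power_Suc)
  qed
  have "((\<lambda>x. \<Sum>i. a i x) \<longlongrightarrow> suminf b) at_top"
  proof (rule tannerys_theorem[THEN conjunct2, THEN conjunct2])
    show "((\<lambda>x. a i x) \<longlongrightarrow> b i) at_top" for i
      unfolding a_def b_def
      using p1 by (intro tendsto_intros has_density_dilate d) auto
    show "\<forall>\<^sub>F (k, n) in sequentially \<times>\<^sub>F at_top. norm (a k n) \<le> 1 / real p ^ Suc k"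
      using bound by (intro always_eventually) auto
    show "summable (\<lambda>k. 1 / real p ^ Suc k)" by (rule summable_inverse_prime_powers[OF p])
  qed simp
  moreover have "suminf b = d * (1 - local_factor h p)"
  proof -
    \<comment> \<open>The difference of consecutive inverse powers of \<open>p\<close> is (p - 1) /
      p times the larger one; this is the source of that weight in
      \<open>local_factor\<close>.\<close>
    have "b i = d * ((real p - 1) / real p) * (real (h (Suc i) p) / real p ^ Suc i)" for i
      using p1 by (simp add: b_def field_simps)
    then have "suminf b = d * ((real p - 1) / real p) * ?S"
      using suminf_mult[OF summable_local_series[OF h p]] by presburger
    then show ?thesis by (simp add: local_factor_def)
  qed
  ultimately have "((\<lambda>x. real (card (initial (B \<inter> bad h p) x)) / x) \<longlongrightarrow> d * (1 - local_factor h p)) at_top"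
    by (simp only: suma)
  with d have "((\<lambda>x. real (card (initial B x)) / x - real (card (initial (B \<inter> bad h p) x)) / x)
      \<longlongrightarrow> d - d * (1 - local_factor h p)) at_top"
    unfolding has_density_def by (rule tendsto_diff)
  moreover have "real (card (initial B x)) / x - real (card (initial (B \<inter> bad h p) x)) / x =
      real (card (initial (B - bad h p) x)) / x" for x
  proof -
    have sub: "initial (B \<inter> bad h p) x \<subseteq> initial B x" by (auto simp: initial_def)
    have "initial (B - bad h p) x = initial B x - initial (B \<inter> bad h p) x" by (auto simp: initial_def)
    then have "real (card (initial (B - bad h p) x)) =
        real (card (initial B x)) - real (card (initial (B \<inter> bad h p) x))"
      using card_mono[OF finite_initial sub]
      by (simp add: card_Diff_subset[OF finite_initial sub] of_nat_diff)
    then show ?thesis by (simp add: diff_divide_distrib)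
  qed
  ultimately show ?thesis by (simp add: has_density_def algebra_simps)
qed

text \<open>A different prime factor leaves the exponent of \<open>p\<close> alone. This supplies
  the invariance required when a new prime joins a finite set.\<close>

lemma mult_prime_bad_iff:
  assumes "prime p" "prime q" "p \<noteq> q" "n > 0"
  shows "q * n \<in> bad h p \<longleftrightarrow> n \<in> bad h p"
proof -
  have "\<not> p dvd q" using assms primes_dvd_imp_eq by blast
  then have "multiplicity p (q * n) = multiplicity p n"
    using assms by (subst multiplicity_prime_elem_times_other) auto
  moreover have "p dvd q * n \<longleftrightarrow> p dvd n"
    using assms \<open>\<not> p dvd q\<close> by (simp add: prime_dvd_mult_iff)
  ultimately show ?thesis by (simp add: bad_def)
qed

lemma has_density_finite_primes:
  assumes h: "zero_one_valued h" and "finite P" "\<And>p. p \<in> P \<Longrightarrow> prime p"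
  shows "has_density (- (\<Union>p\<in>P. bad h p)) (\<Prod>p\<in>P. local_factor h p)"
  using assms(2,3)
proof (induction P rule: finite_induct)
  case empty
  then show ?case using has_density_UNIV by simp
next
  case (insert p P)
  have inv: "p * n \<in> - (\<Union>p\<in>P. bad h p) \<longleftrightarrow> n \<in> - (\<Union>p\<in>P. bad h p)" if "n > 0" for n
  proof -
    have "p * n \<in> bad h q \<longleftrightarrow> n \<in> bad h q" if "q \<in> P" for q
      using that insert.hyps insert.prems \<open>n > 0\<close> by (intro mult_prime_bad_iff) auto
    then show ?thesis by simp
  qed
  have "- (\<Union>p\<in>insert p P. bad h p) = - (\<Union>p\<in>P. bad h p) - bad h p" by auto
  moreover have "has_density (- (\<Union>p\<in>P. bad h p) - bad h p)
      ((\<Prod>p\<in>P. local_factor h p) * local_factor h p)"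
    by (rule has_density_diff_bad[OF h _ _ inv]) (use insert in auto)
  ultimately show ?case using insert by (simp add: mult.commute)
qed

section \<open>Reduction to a sieve and control of the large primes\<close>

lemma exponent_sum_eq_0_iff:
  assumes "n > 0"
  shows "exponent_sum h n = 0 \<longleftrightarrow> (\<forall>p. prime p \<longrightarrow> n \<notin> bad h p)"
  using assms by (auto simp: exponent_sum_def bad_def in_prime_factors_iff)

lemma Q_eq_card_initial: "Q x h = card (initial (- (\<Union>p\<in>{p. prime p}. bad h p)) x)"
  unfolding Q_def by (rule arg_cong[where f = card]) (auto simp: initial_def exponent_sum_eq_0_iff)

text \<open>An integer up to \<open>x\<close> that passes at all primes up to \<open>k\<close> but
  fails somewhere fails at a prime \<open>p > k\<close> dividing it, whence
  \<open>p \<le> x\<close>. A union bound with \<open>card_initial_bad_le\<close> pays for these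
  failures.\<close>

lemma Q_lower_bound:
  fixes k :: nat
  assumes h: "zero_one_valued h" and x: "0 \<le> x"
  shows "real (card (initial (- (\<Union>p\<in>{p. prime p \<and> p \<le> k}. bad h p)) x))
    - 2 * x * (\<Sum>p | prime p \<and> k < p \<and> p \<le> nat \<lfloor>x\<rfloor>. 1 - local_factor h p) \<le> real (Q x h)"
proof -
  let ?T = "{p. prime p \<and> k < p \<and> p \<le> nat \<lfloor>x\<rfloor>}"
  have fin: "finite ?T" by simp
  have "initial (- (\<Union>p\<in>{p. prime p \<and> p \<le> k}. bad h p)) x \<subseteq>
      initial (- (\<Union>p\<in>{p. prime p}. bad h p)) x \<union> (\<Union>p\<in>?T. initial (bad h p) x)"
  proof
    fix n assume n: "n \<in> initial (- (\<Union>p\<in>{p. prime p \<and> p \<le> k}. bad h p)) x"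
    show "n \<in> initial (- (\<Union>p\<in>{p. prime p}. bad h p)) x \<union> (\<Union>p\<in>?T. initial (bad h p) x)"
    proof (cases "\<exists>p. prime p \<and> n \<in> bad h p")
      case True
      then obtain p where p: "prime p" "n \<in> bad h p" by blast
      then have "p \<le> n" using n by (auto simp: bad_def initial_def intro: dvd_imp_le)
      moreover have "n \<le> nat \<lfloor>x\<rfloor>" using n by (auto simp: initial_def le_nat_floor)
      moreover have "\<not> p \<le> k" using n p by (force simp: initial_def)
      ultimately have "p \<in> ?T" using p(1) by simp
      moreover have "n \<in> initial (bad h p) x" using n p(2) by (simp add: initial_def)
      ultimately show ?thesis by blast
    qed (use n in \<open>auto simp: initial_def\<close>)
  qed
  then have "card (initial (- (\<Union>p\<in>{p. prime p \<and> p \<le> k}. bad h p)) x) \<le>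
      card (initial (- (\<Union>p\<in>{p. prime p}. bad h p)) x \<union> (\<Union>p\<in>?T. initial (bad h p) x))"
    by (intro card_mono) (auto simp: fin)
  also have "\<dots> \<le> Q x h + card (\<Union>p\<in>?T. initial (bad h p) x)"
    unfolding Q_eq_card_initial by (rule card_Un_le)
  also have "\<dots> \<le> Q x h + (\<Sum>p\<in>?T. card (initial (bad h p) x))"
    by (intro add_left_mono card_UN_le fin)
  finally have "real (card (initial (- (\<Union>p\<in>{p. prime p \<and> p \<le> k}. bad h p)) x)) \<le>
      real (Q x h + (\<Sum>p\<in>?T. card (initial (bad h p) x)))"
    by (rule of_nat_mono)
  also have "\<dots> = real (Q x h) + (\<Sum>p\<in>?T. real (card (initial (bad h p) x)))"
    by simp
  finally have "real (card (initial (- (\<Union>p\<in>{p. prime p \<and> p \<le> k}. bad h p)) x)) \<le>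
      real (Q x h) + (\<Sum>p\<in>?T. real (card (initial (bad h p) x)))" .
  moreover have "(\<Sum>p\<in>?T. real (card (initial (bad h p) x))) \<le> (\<Sum>p\<in>?T. 2 * x * (1 - local_factor h p))"
    by (intro sum_mono card_initial_bad_le h x) auto
  ultimately show ?thesis by (simp add: sum_distrib_left)
qed

text \<open>The inequality 1 - t \<le> exp (-t) turns the lower bound \<open>L\<close> on the
  products into the upper bound \<open>- ln L\<close> on the partial sums.\<close>

lemma summable_of_prod_bounded_below:
  fixes e :: "nat \<Rightarrow> real"
  assumes e: "\<And>i. 0 \<le> e i" "\<And>i. e i \<le> 1" and L: "0 < L" "\<And>k. L \<le> (\<Prod>i<k. 1 - e i)"
  shows "summable e"
proof (rule summableI_nonneg_bounded[OF e(1)])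
  fix k
  have "L \<le> (\<Prod>i<k. 1 - e i)" by (rule L)
  also have "\<dots> \<le> (\<Prod>i<k. exp (- e i))"
    using e(2) exp_ge_add_one_self[of "- e _"] by (intro prod_mono) auto
  also have "\<dots> = exp (- (\<Sum>i<k. e i))"
    by (simp add: exp_sum sum_negf[symmetric])
  finally show "(\<Sum>i<k. e i) \<le> - ln L"
    using L(1) by (simp add: ln_ge_iff le_minus_iff ln_le_cancel_iff[symmetric])
qed

section \<open>Passage to all primes\<close>

theorem theorem4:
  fixes h :: "nat \<Rightarrow> nat \<Rightarrow> nat"
  assumes "zero_one_valued h"
  shows "\<exists>L::real. ((\<lambda>x::real. real (Q x h) / x) \<longlongrightarrow> L) at_top \<and>
           ((\<lambda>y::real. \<Prod>p | prime p \<and> real p \<le> y. local_factor h p) \<longlongrightarrow> L) at_top"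
proof -
  \<comment> \<open>The violation density at \<open>p\<close>, extended by 0 so that products and
    sums over primes run over intervals of naturals.\<close>
  define e where "e p = (if prime p then 1 - local_factor h p else 0)" for p :: nat
  define F where "F k = (\<Prod>p | prime p \<and> p \<le> k. local_factor h p)" for k
  define A where "A k = - (\<Union>p\<in>{p. prime p \<and> p \<le> k}. bad h p)" for k
  have e: "0 \<le> e p" "e p \<le> 1" for p
    using local_factor_bounds[OF assms, of p] by (auto simp: e_def)
  have F_eq: "F k = (\<Prod>p<Suc k. 1 - e p)" for k
    unfolding F_def by (rule prod.mono_neutral_cong_left) (auto simp: e_def)
  have F_nonneg: "0 \<le> F k" for k
    using e by (simp only: F_eq) (intro prod_nonneg, simp)
  have "decseq F"
  proof (rule decseq_SucI)
    fix k
    have "F (Suc k) = F k * (1 - e (Suc k))" by (simp add: F_eq)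
    also have "\<dots> \<le> F k * 1" using e by (intro mult_left_mono F_nonneg) simp
    finally show "F (Suc k) \<le> F k" by simp
  qed
  then obtain L where L: "F \<longlonglongrightarrow> L" "\<And>k. L \<le> F k"
    using decseq_convergent[of F 0] F_nonneg by blast
  have L_nonneg: "0 \<le> L" by (rule LIMSEQ_le_const[OF L(1)]) (use F_nonneg in auto)
  have dens: "has_density (A k) (F k)" for k
    unfolding A_def F_def by (rule has_density_finite_primes[OF assms]) auto
  \<comment> \<open>Ignoring the primes beyond \<open>k\<close> only enlarges the counted set, whose
    density \<open>F k\<close> drops below \<open>u\<close> for suitable \<open>k\<close>.\<close>
  have upper: "\<forall>\<^sub>F x in at_top. real (Q x h) / x < u" if "L < u" for u
  proof -
    from order_tendstoD(2)[OF L(1) that] obtain k where "F k < u"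
      by (metis eventually_sequentially order_refl)
    from order_tendstoD(2)[OF dens[of k, unfolded has_density_def] this] eventually_gt_at_top[of 0]
    show ?thesis
    proof eventually_elim
      case (elim x)
      have "card (initial (- (\<Union>p\<in>{p. prime p}. bad h p)) x) \<le> card (initial (A k) x)"
        by (intro card_initial_mono) (auto simp: A_def)
      then have "real (Q x h) / x \<le> real (card (initial (A k) x)) / x"
        using elim by (simp add: Q_eq_card_initial divide_right_mono)
      with elim show ?case by simp
    qed
  qed
  have lower: "\<forall>\<^sub>F x in at_top. l < real (Q x h) / x" if "l < L" for l
  proof (cases "L = 0")
    case True
    have "\<forall>\<^sub>F x in at_top. (0::real) < x" by (rule eventually_gt_at_top)
    then show ?thesis
    proof eventually_elim
      case (elim x)
      then have "0 \<le> real (Q x h) / x" by simp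
      with True that show ?case by linarith
    qed
  next
    case False
    \<comment> \<open>\<open>F j\<close> is the product over \<open>p < Suc j\<close>, so the empty
      product is treated apart; it equals \<open>F 0\<close> because 0 is not prime.\<close>
    have "L \<le> (\<Prod>p<k. 1 - e p)" for k
    proof (cases k)
      case 0
      have "F 0 = 1" by (simp add: F_eq e_def)
      then show ?thesis using L(2)[of 0] 0 by simp
    next
      case (Suc j)
      then show ?thesis using L(2)[of j] by (simp only: F_eq)
    qed
    then have "summable e"
      using False L_nonneg e by (intro summable_of_prod_bounded_below[of e L]) auto
    \<comment> \<open>Half of the gap \<open>L - l\<close> is kept for the tail: its sum is made
      less than a quarter of the gap, since \<open>Q_lower_bound\<close> doubles it. The truncated
      count exceeds the midpoint of \<open>l\<close> and \<open>L\<close> times \<open>x\<close>, so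
      more than \<open>l * x\<close> remains.\<close>
    moreover have "0 < (L - l) / 2" using that by simp
    ultimately obtain k where k: "\<And>m n. m \<ge> k \<Longrightarrow> norm (sum e {m..<n}) < (L - l) / 2 / 2"
      unfolding summable_Cauchy using half_gt_zero by metis
    have "l + (L - l) / 2 < F k" using that L(2)[of k] by (simp add: field_simps)
    from order_tendstoD(1)[OF dens[of k, unfolded has_density_def] this] eventually_gt_at_top[of 0]
    show ?thesis
    proof eventually_elim
      case (elim x)
      have "(\<Sum>p | prime p \<and> k < p \<and> p \<le> nat \<lfloor>x\<rfloor>. 1 - local_factor h p) = sum e {Suc k..<Suc (nat \<lfloor>x\<rfloor>)}"
        by (rule sum.mono_neutral_cong_left) (auto simp: e_def)
      also have "\<dots> < (L - l) / 2 / 2"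
        using k[of "Suc k" "Suc (nat \<lfloor>x\<rfloor>)"] by simp
      finally have "2 * x * (\<Sum>p | prime p \<and> k < p \<and> p \<le> nat \<lfloor>x\<rfloor>. 1 - local_factor h p)
          < 2 * x * ((L - l) / 2 / 2)"
        using elim by (intro mult_strict_left_mono) auto
      with Q_lower_bound[OF assms order.strict_implies_order[OF elim(2)], of k, folded A_def]
      have "real (card (initial (A k) x)) - 2 * x * ((L - l) / 2 / 2) < real (Q x h)"
        by linarith
      moreover have "(l + (L - l) / 2) * x < real (card (initial (A k) x))"
        using elim by (simp add: pos_less_divide_eq)
      moreover have "2 * x * ((L - l) / 2 / 2) = (L - l) / 2 * x" by simp
      ultimately have "l * x < real (Q x h)" unfolding distrib_right by linarith
      then show ?case using elim by (simp add: pos_less_divide_eq)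
    qed
  qed
  have "((\<lambda>x. real (Q x h) / x) \<longlongrightarrow> L) at_top"
    using upper lower by (intro order_tendstoI)
  moreover have "((\<lambda>y. \<Prod>p | prime p \<and> real p \<le> y. local_factor h p) \<longlongrightarrow> L) at_top"
  \<comment> \<open>The real cutoff \<open>y\<close> is reduced to the sequence \<open>F\<close> at
    the integer part of \<open>y\<close>.\<close>
  proof (rule Lim_transform_eventually)
    show "((\<lambda>y::real. F (nat \<lfloor>y\<rfloor>)) \<longlongrightarrow> L) at_top"
      by (intro filterlim_compose[OF L(1)] filterlim_compose[OF filterlim_nat_sequentially]
          filterlim_floor_sequentially)
    show "\<forall>\<^sub>F y in at_top. F (nat \<lfloor>y\<rfloor>) = (\<Prod>p | prime p \<and> real p \<le> y. local_factor h p)"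
      using eventually_ge_at_top[of 0]
    proof eventually_elim
      case (elim y)
      then have "real p \<le> y \<longleftrightarrow> p \<le> nat \<lfloor>y\<rfloor>" for p
        by (simp add: le_nat_iff le_floor_iff)
      then show ?case by (simp add: F_def)
    qed
  qed
  ultimately show ?thesis by blast
qed

end
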